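(* Let $D$ be a finite generalized digroup, fix a bar-unit $\xi\in\mathrm{Halo}(D)$, and identify $D\simeq G\times E$ with $G=G_l^{\xi}$ and $E=\mathrm{Halo}(D)$ by the structure isomorphism recalled in the context. Let $\pi:G\times E\to G$, $\pi(g,\alpha)=g$. Let $X\subseteq G\times E$ be a nonempty subset, and define $$Y:=\pi(X)\subseteq G,\qquad X_g:=\{\beta\in E\mid(g,\beta)\in X\}\quad(g\in Y).$$ Then $X$ is a subrack of $\mathrm{Conj}(D)$ if and only if the following conditions hold: (1) $Y$ is a subrack of $\mathrm{Conj}(G)$; (2) for every $g,h\in Y$, $\ g\bullet X_h\subseteq X_{ghg^{-1}}$.
   Context: A generalized digroup is a nonempty set $D$ with two associative binary operations $\vdash,\dashv$ satisfying $x\vdash(y\dashv z)=(x\vdash y)\dashv z$, $x\dashv(y\dashv z)=x\dashv(y\vdash z)$, $(x\vdash y)\vdash z=(x\dashv y)\vdash z$, such that there is at least one bar-unit (an element $\xi$ with $x\dashv\xi=x=\xi\vdash x$ for all $x\in D$), and for every bar-unit $\xi$ and every $x\in D$ there are $x^{-1}_{r,\xi},x^{-1}_{l,\xi}\in D$ with $x\vdash x^{-1}_{r,\xi}=\xi$ and $x^{-1}_{l,\xi}\dashv x=\xi$. $\mathrm{Halo}(D)$ is the set of bar-units. Structure isomorphism (known): fix a bar-unit $\xi$. Let $G:=G_l^\xi=\{\xi\dashv x\mid x\in D\}$, the left group associated with $\xi$; it is a group under $\dashv$ with identity $\xi$ (law written multiplicatively). Let $E:=\mathrm{Halo}(D)$,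 a left $G$-set via $g\bullet\alpha:=g\vdash\alpha\dashv g^{-1}$ ($g^{-1}$ the inverse in $G$). Then $G\times E$ with $(g,\alpha)\vdash(h,\beta)=(gh,g\bullet\beta)$ and $(g,\alpha)\dashv(h,\beta)=(gh,\alpha)$ is a generalized digroup, and $x\mapsto(\xi\dashv x,\ x\dashv x^{-1}_{l,\xi})$ is an isomorphism $D\to G\times E$, used to identify them. A rack is a nonempty set $X$ with a binary operation $\triangleright$ such that each left translation $L_x(y)=x\triangleright y$ is bijective and $x\triangleright(y\triangleright z)=(x\triangleright y)\triangleright(x\triangleright z)$. A subrack is a nonempty subset closed under $\triangleright$ and under the inverse left translations (for finite racks closure under $\triangleright$ suffices). The conjugation rack $\mathrm{Conj}(D)$ is the set $D$ with $x\triangleright y:=(x\vdash y)\dashv x^{-1}$, where $x^{-1}$ is any one-sided inverse of $x$ (right for $\vdash$ or left for $\dashv$) relative to a bar-unit; this is independent of the choice. $\mathrm{Conj}(G)$ is the group $G$ with $g\triangleright h=ghg^{-1}$. For $F\subseteq E$, $g\bullet F=\{g\bullet\beta\mid\beta\in F\}$. *)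

theory Defs
  imports "HOL-Algebra.Group"
begin

section \<open>Generalized digroups\<close>

record 'a digroup = "'a partial_object" +
  vdash :: "'a \<Rightarrow> 'a \<Rightarrow> 'a"  (infixl "\<turnstile>\<index>" 70)
  dashv :: "'a \<Rightarrow> 'a \<Rightarrow> 'a"  (infixl "\<stileturn>\<index>" 70)

definition bar_unit :: "('a, 'm) digroup_scheme \<Rightarrow> 'a \<Rightarrow> bool" where
  "bar_unit D \<xi> \<longleftrightarrow> \<xi> \<in> carrier D \<and> (\<forall>x \<in> carrier D. x \<stileturn>\<^bsub>D\<^esub> \<xi> = x \<and> \<xi> \<turnstile>\<^bsub>D\<^esub> x = x)"

definition Halo :: "('a, 'm) digroup_scheme \<Rightarrow> 'a set" where
  "Halo D = {\<xi>. bar_unit D \<xi>}"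

definition is_right_inv :: "('a, 'm) digroup_scheme \<Rightarrow> 'a \<Rightarrow> 'a \<Rightarrow> 'a \<Rightarrow> bool" where
  "is_right_inv D \<xi> x z \<longleftrightarrow> z \<in> carrier D \<and> x \<turnstile>\<^bsub>D\<^esub> z = \<xi>"

definition is_left_inv :: "('a, 'm) digroup_scheme \<Rightarrow> 'a \<Rightarrow> 'a \<Rightarrow> 'a \<Rightarrow> bool" where
  "is_left_inv D \<xi> x z \<longleftrightarrow> z \<in> carrier D \<and> z \<stileturn>\<^bsub>D\<^esub> x = \<xi>"

locale generalized_digroup =
  fixes D (structure)
  assumes vdash_closed: "\<lbrakk>x \<in> carrier D; y \<in> carrier D\<rbrakk> \<Longrightarrow> x \<turnstile> y \<in> carrier D"
    and dashv_closed: "\<lbrakk>x \<in> carrier D; y \<in> carrier D\<rbrakk> \<Longrightarrow> x \<stileturn> y \<in> carrier D"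
    and vdash_assoc: "\<lbrakk>x \<in> carrier D; y \<in> carrier D; z \<in> carrier D\<rbrakk>
      \<Longrightarrow> (x \<turnstile> y) \<turnstile> z = x \<turnstile> (y \<turnstile> z)"
    and dashv_assoc: "\<lbrakk>x \<in> carrier D; y \<in> carrier D; z \<in> carrier D\<rbrakk>
      \<Longrightarrow> (x \<stileturn> y) \<stileturn> z = x \<stileturn> (y \<stileturn> z)"
    and inner_assoc: "\<lbrakk>x \<in> carrier D; y \<in> carrier D; z \<in> carrier D\<rbrakk>
      \<Longrightarrow> x \<turnstile> (y \<stileturn> z) = (x \<turnstile> y) \<stileturn> z"
    and dashv_bar: "\<lbrakk>x \<in> carrier D; y \<in> carrier D; z \<in> carrier D\<rbrakk>
      \<Longrightarrow> x \<stileturn> (y \<stileturn> z) = x \<stileturn> (y \<turnstile> z)"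
    and vdash_bar: "\<lbrakk>x \<in> carrier D; y \<in> carrier D; z \<in> carrier D\<rbrakk>
      \<Longrightarrow> (x \<turnstile> y) \<turnstile> z = (x \<stileturn> y) \<turnstile> z"
    and Halo_nonempty: "Halo D \<noteq> {}"
    and right_inv_ex: "\<lbrakk>\<xi> \<in> Halo D; x \<in> carrier D\<rbrakk> \<Longrightarrow> \<exists>z. is_right_inv D \<xi> x z"
    and left_inv_ex: "\<lbrakk>\<xi> \<in> Halo D; x \<in> carrier D\<rbrakk> \<Longrightarrow> \<exists>z. is_left_inv D \<xi> x z"

definition left_inv :: "('a, 'm) digroup_scheme \<Rightarrow> 'a \<Rightarrow> 'a \<Rightarrow> 'a" where
  "left_inv D \<xi> x = (SOME z. is_left_inv D \<xi> x z)"


section \<open>The left group, its action on the halo, and the structure isomorphism\<close>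

definition left_group :: "('a, 'm) digroup_scheme \<Rightarrow> 'a \<Rightarrow> 'a monoid" where
  "left_group D \<xi> =
    \<lparr>carrier = {\<xi> \<stileturn>\<^bsub>D\<^esub> x |x. x \<in> carrier D}, mult = (\<stileturn>\<^bsub>D\<^esub>), one = \<xi>\<rparr>"

definition halo_act :: "('a, 'm) digroup_scheme \<Rightarrow> 'a \<Rightarrow> 'a \<Rightarrow> 'a \<Rightarrow> 'a" where
  "halo_act D \<xi> g \<alpha> = (g \<turnstile>\<^bsub>D\<^esub> \<alpha>) \<stileturn>\<^bsub>D\<^esub> inv\<^bsub>left_group D \<xi>\<^esub> g"

definition product_digroup :: "('a, 'm) digroup_scheme \<Rightarrow> 'a \<Rightarrow> ('a \<times> 'a) digroup" where
  "product_digroup D \<xi> =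
    \<lparr>carrier = carrier (left_group D \<xi>) \<times> Halo D,
     vdash = (\<lambda>(g, \<alpha>) (h, \<beta>). (g \<otimes>\<^bsub>left_group D \<xi>\<^esub> h, halo_act D \<xi> g \<beta>)),
     dashv = (\<lambda>(g, \<alpha>) (h, \<beta>). (g \<otimes>\<^bsub>left_group D \<xi>\<^esub> h, \<alpha>))\<rparr>"

definition structure_map :: "('a, 'm) digroup_scheme \<Rightarrow> 'a \<Rightarrow> 'a \<Rightarrow> 'a \<times> 'a" where
  "structure_map D \<xi> x = (\<xi> \<stileturn>\<^bsub>D\<^esub> x, x \<stileturn>\<^bsub>D\<^esub> left_inv D \<xi> x)"


section \<open>Racks\<close>

record 'a rack_struct = "'a partial_object" +
  rack_op :: "'a \<Rightarrow> 'a \<Rightarrow> 'a"  (infixl "\<triangleright>\<index>" 70)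

locale rack =
  fixes R (structure)
  assumes nonempty: "carrier R \<noteq> {}"
    and bij: "x \<in> carrier R \<Longrightarrow> bij_betw (\<lambda>y. x \<triangleright> y) (carrier R) (carrier R)"
    and self_dist: "\<lbrakk>x \<in> carrier R; y \<in> carrier R; z \<in> carrier R\<rbrakk>
      \<Longrightarrow> x \<triangleright> (y \<triangleright> z) = (x \<triangleright> y) \<triangleright> (x \<triangleright> z)"

definition subrack :: "'a set \<Rightarrow> ('a, 'm) rack_struct_scheme \<Rightarrow> bool" where
  "subrack S R \<longleftrightarrow> S \<noteq> {} \<and> S \<subseteq> carrier R \<and>
    (\<forall>x \<in> S. \<forall>y \<in> S. x \<triangleright>\<^bsub>R\<^esub> y \<in> S) \<and>
    (\<forall>x \<in> S. \<forall>y \<in> S. inv_into (carrier R) (\<lambda>z. x \<triangleright>\<^bsub>R\<^esub> z) y \<in> S)"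

definition Conj_group :: "('a, 'm) monoid_scheme \<Rightarrow> 'a rack_struct" where
  "Conj_group G =
    \<lparr>carrier = carrier G, rack_op = (\<lambda>g h. g \<otimes>\<^bsub>G\<^esub> h \<otimes>\<^bsub>G\<^esub> inv\<^bsub>G\<^esub> g)\<rparr>"

definition is_one_sided_inv :: "('a, 'm) digroup_scheme \<Rightarrow> 'a \<Rightarrow> 'a \<Rightarrow> bool" where
  "is_one_sided_inv D x z \<longleftrightarrow> (\<exists>\<xi> \<in> Halo D. is_right_inv D \<xi> x z \<or> is_left_inv D \<xi> x z)"

text \<open>The choice of one-sided inverse is immaterial: see \<open>Conj_eq\<close> below.\<close>

definition Conj :: "('a, 'm) digroup_scheme \<Rightarrow> 'a rack_struct" where
  "Conj D =
    \<lparr>carrier = carrier D,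
     rack_op = (\<lambda>x y. (x \<turnstile>\<^bsub>D\<^esub> y) \<stileturn>\<^bsub>D\<^esub> (SOME z. is_one_sided_inv D x z))\<rparr>"


section \<open>Well-definedness of the constructions\<close>

lemma (in group) inv_cancel:
  assumes "x \<in> carrier G" "y \<in> carrier G"
  shows "inv x \<otimes> (x \<otimes> y) = y" "x \<otimes> (inv x \<otimes> y) = y"
  using assms by (simp_all flip: m_assoc)

theorem (in group) rack_Conj_group: "rack (Conj_group G)"
proof (unfold_locales, goal_cases)
  case (2 x)
  then have "bij_betw (\<lambda>y. x \<otimes> y \<otimes> inv x) (carrier G) (carrier G)"
    by (intro bij_betw_byWitness[where f' = "\<lambda>y. inv x \<otimes> y \<otimes> x"])
      (auto simp: Conj_group_def m_assoc inv_cancel)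
  then show ?case by (simp add: Conj_group_def)
next
  case (3 x y z)
  then show ?case by (simp add: Conj_group_def m_assoc inv_mult_group inv_cancel)
qed (auto simp: Conj_group_def)

context generalized_digroup
begin

lemma HaloD:
  assumes "\<xi> \<in> Halo D"
  shows "\<xi> \<in> carrier D" "x \<in> carrier D \<Longrightarrow> x \<stileturn> \<xi> = x" "x \<in> carrier D \<Longrightarrow> \<xi> \<turnstile> x = x"
  using assms by (auto simp: Halo_def bar_unit_def)

lemma left_group_closed: "\<lbrakk>\<xi> \<in> Halo D; g \<in> carrier (left_group D \<xi>)\<rbrakk> \<Longrightarrow> g \<in> carrier D"
  by (auto simp: left_group_def HaloD(1) dashv_closed)

lemma left_group_group:
  assumes xi: "\<xi> \<in> Halo D"
  shows "group (left_group D \<xi>)"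
proof (rule groupI)
  note H = HaloD[OF xi]
  fix g h assume g: "g \<in> carrier (left_group D \<xi>)" and h: "h \<in> carrier (left_group D \<xi>)"
  have gh: "g \<in> carrier D" "h \<in> carrier D" using g h left_group_closed[OF xi] by auto
  obtain x where x: "x \<in> carrier D" "g = \<xi> \<stileturn> x" using g by (auto simp: left_group_def)
  have "g \<stileturn> h = \<xi> \<stileturn> (x \<stileturn> h)" using x gh H dashv_assoc by auto
  then show "g \<otimes>\<^bsub>left_group D \<xi>\<^esub> h \<in> carrier (left_group D \<xi>)"
    using x gh by (auto simp: left_group_def dashv_closed)
  have "\<xi> \<stileturn> g = g" using x H by (simp flip: dashv_assoc)
  then show "\<one>\<^bsub>left_group D \<xi>\<^esub> \<otimes>\<^bsub>left_group D \<xi>\<^esub> g = g" by (simp add: left_group_def)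
  obtain y where y: "y \<in> carrier D" "y \<stileturn> g = \<xi>"
    using left_inv_ex[OF xi gh(1)] by (auto simp: is_left_inv_def)
  have "(\<xi> \<stileturn> y) \<stileturn> g = \<xi>" using y gh H by (simp add: dashv_assoc)
  then show "\<exists>y \<in> carrier (left_group D \<xi>).
      y \<otimes>\<^bsub>left_group D \<xi>\<^esub> g = \<one>\<^bsub>left_group D \<xi>\<^esub>"
    using y by (auto simp: left_group_def)
next
  note H = HaloD[OF xi]
  show "\<one>\<^bsub>left_group D \<xi>\<^esub> \<in> carrier (left_group D \<xi>)"
    using H(1) H(2)[OF H(1)] by (force simp: left_group_def)
qed (auto simp: left_group_def HaloD[OF xi] dashv_assoc dashv_closed)

lemma left_proj_vdash:
  assumes "\<xi> \<in> Halo D" "x \<in> carrier D" "y \<in> carrier D"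
  shows "(\<xi> \<stileturn> x) \<turnstile> y = x \<turnstile> y"
  using assms by (simp add: HaloD flip: vdash_bar)

lemma dashv_left_proj:
  assumes "\<xi> \<in> Halo D" "x \<in> carrier D" "y \<in> carrier D"
  shows "y \<stileturn> (\<xi> \<stileturn> x) = y \<stileturn> x"
  using assms by (simp add: HaloD flip: dashv_assoc)

lemma left_proj_Halo:
  assumes "\<xi> \<in> Halo D" "\<eta> \<in> Halo D"
  shows "\<xi> \<stileturn> \<eta> = \<xi>"
  using assms by (simp add: HaloD)

lemma left_proj_dashv:
  assumes "\<xi> \<in> Halo D" "x \<in> carrier D" "y \<in> carrier D"
  shows "\<xi> \<stileturn> (x \<stileturn> y) = (\<xi> \<stileturn> x) \<otimes>\<^bsub>left_group D \<xi>\<^esub> (\<xi> \<stileturn> y)"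
  using assms by (simp add: left_group_def HaloD dashv_left_proj dashv_closed dashv_assoc)

lemma left_proj_closed:
  "x \<in> carrier D \<Longrightarrow> \<xi> \<stileturn> x \<in> carrier (left_group D \<xi>)"
  by (auto simp: left_group_def)

lemma left_proj_inv:
  assumes xi: "\<xi> \<in> Halo D" and x: "x \<in> carrier D" and z: "is_one_sided_inv D x z"
  shows "z \<in> carrier D" "\<xi> \<stileturn> z = inv\<^bsub>left_group D \<xi>\<^esub> (\<xi> \<stileturn> x)"
proof -
  interpret G: group "left_group D \<xi>" by (rule left_group_group[OF xi])
  obtain \<eta> where eta: "\<eta> \<in> Halo D" "z \<in> carrier D" "x \<turnstile> z = \<eta> \<or> z \<stileturn> x = \<eta>"
    using z by (auto simp: is_one_sided_inv_def is_right_inv_def is_left_inv_def)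
  then show "z \<in> carrier D" by simp
  have one: "\<xi> \<stileturn> \<eta> = \<one>\<^bsub>left_group D \<xi>\<^esub>"
    using left_proj_Halo[OF xi eta(1)] by (simp add: left_group_def)
  from eta(3) have "\<xi> \<stileturn> (x \<stileturn> z) = \<one>\<^bsub>left_group D \<xi>\<^esub> \<or> \<xi> \<stileturn> (z \<stileturn> x) = \<one>\<^bsub>left_group D \<xi>\<^esub>"
    using one dashv_bar[OF HaloD(1)[OF xi] x eta(2)] by auto
  then show "\<xi> \<stileturn> z = inv\<^bsub>left_group D \<xi>\<^esub> (\<xi> \<stileturn> x)"
    using G.inv_equality G.inv_equality[of "\<xi> \<stileturn> x" "\<xi> \<stileturn> z"] x eta(2)
      left_proj_closed[of x \<xi>] left_proj_closed[of z \<xi>]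
    by (metis G.inv_inv left_proj_dashv xi)
qed

lemma one_sided_inv_ex: "x \<in> carrier D \<Longrightarrow> \<exists>z. is_one_sided_inv D x z"
  using Halo_nonempty left_inv_ex by (fastforce simp: is_one_sided_inv_def)

lemma dashv_one_sided_inv:
  assumes "\<xi> \<in> Halo D" "x \<in> carrier D" "y \<in> carrier D" "is_one_sided_inv D x z"
  shows "y \<stileturn> z = y \<stileturn> inv\<^bsub>left_group D \<xi>\<^esub> (\<xi> \<stileturn> x)"
  using assms left_proj_inv dashv_left_proj by metis

lemma Conj_eq:
  assumes x: "x \<in> carrier D" and y: "y \<in> carrier D" and z: "is_one_sided_inv D x z"
  shows "x \<triangleright>\<^bsub>Conj D\<^esub> y = (x \<turnstile> y) \<stileturn> z"
proof -
  obtain \<xi> where xi: "\<xi> \<in> Halo D" using Halo_nonempty by auto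
  have "is_one_sided_inv D x (SOME z. is_one_sided_inv D x z)"
    using z by (rule someI)
  then show ?thesis
    using dashv_one_sided_inv[OF xi x vdash_closed[OF x y]] z by (simp add: Conj_def)
qed

lemma Conj_act:
  assumes xi: "\<xi> \<in> Halo D" and x: "x \<in> carrier D" and y: "y \<in> carrier D"
  shows "x \<triangleright>\<^bsub>Conj D\<^esub> y = halo_act D \<xi> (\<xi> \<stileturn> x) y"
proof -
  obtain z where z: "is_one_sided_inv D x z" using one_sided_inv_ex[OF x] by auto
  show ?thesis
    using Conj_eq[OF x y z] dashv_one_sided_inv[OF xi x vdash_closed[OF x y] z]
    by (simp add: halo_act_def left_proj_vdash xi x y)
qed

lemma halo_act_closed:
  assumes "\<xi> \<in> Halo D" "g \<in> carrier (left_group D \<xi>)" "y \<in> carrier D"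
  shows "halo_act D \<xi> g y \<in> carrier D"
  unfolding halo_act_def
  using assms left_group_closed group.inv_closed[OF left_group_group]
  by (simp add: vdash_closed dashv_closed)

lemma halo_act_one:
  assumes "\<xi> \<in> Halo D" "y \<in> carrier D"
  shows "halo_act D \<xi> \<xi> y = y"
proof -
  have "inv\<^bsub>left_group D \<xi>\<^esub> \<xi> = \<xi>"
    using monoid.inv_one[OF group.is_monoid[OF left_group_group[OF assms(1)]]]
    by (simp add: left_group_def)
  then show ?thesis using assms by (simp add: halo_act_def HaloD)
qed

lemma halo_act_mult:
  assumes xi: "\<xi> \<in> Halo D" and g: "g \<in> carrier (left_group D \<xi>)"
    and h: "h \<in> carrier (left_group D \<xi>)" and y: "y \<in> carrier D"
  shows "halo_act D \<xi> (g \<otimes>\<^bsub>left_group D \<xi>\<^esub> h) y = halo_act D \<xi> g (halo_act D \<xi> h y)"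
proof -
  interpret G: group "left_group D \<xi>" by (rule left_group_group[OF xi])
  define g' h' where "g' = inv\<^bsub>left_group D \<xi>\<^esub> g" and "h' = inv\<^bsub>left_group D \<xi>\<^esub> h"
  have c: "g \<in> carrier D" "h \<in> carrier D" "g' \<in> carrier D" "h' \<in> carrier D"
    using g h left_group_closed[OF xi] by (auto simp: g'_def h'_def)
  have "inv\<^bsub>left_group D \<xi>\<^esub> (g \<otimes>\<^bsub>left_group D \<xi>\<^esub> h) = h' \<stileturn> g'"
    using g h G.inv_mult_group by (simp add: g'_def h'_def) (simp add: left_group_def)
  then have "halo_act D \<xi> (g \<otimes>\<^bsub>left_group D \<xi>\<^esub> h) y = ((g \<stileturn> h) \<turnstile> y) \<stileturn> (h' \<stileturn> g')"
    by (simp add: halo_act_def) (simp add: left_group_def)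
  also have "\<dots> = (g \<turnstile> (h \<turnstile> y)) \<stileturn> (h' \<stileturn> g')"
    using c y by (simp add: vdash_assoc flip: vdash_bar)
  also have "\<dots> = (g \<turnstile> ((h \<turnstile> y) \<stileturn> h')) \<stileturn> g'"
    using c y by (simp add: inner_assoc dashv_assoc vdash_closed dashv_closed)
  finally show ?thesis by (simp add: halo_act_def g'_def h'_def)
qed

lemma left_proj_act:
  assumes xi: "\<xi> \<in> Halo D" and g: "g \<in> carrier (left_group D \<xi>)" and y: "y \<in> carrier D"
  shows "\<xi> \<stileturn> halo_act D \<xi> g y =
    g \<otimes>\<^bsub>left_group D \<xi>\<^esub> (\<xi> \<stileturn> y) \<otimes>\<^bsub>left_group D \<xi>\<^esub> inv\<^bsub>left_group D \<xi>\<^esub> g"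
proof -
  interpret G: group "left_group D \<xi>" by (rule left_group_group[OF xi])
  have c: "g \<in> carrier D" "inv\<^bsub>left_group D \<xi>\<^esub> g \<in> carrier D"
    using g left_group_closed[OF xi] by auto
  have fixed: "\<xi> \<stileturn> k = k" if "k \<in> carrier (left_group D \<xi>)" for k
    using G.l_one[OF that] by (simp add: left_group_def)
  have "\<xi> \<stileturn> halo_act D \<xi> g y = (\<xi> \<stileturn> (g \<turnstile> y)) \<otimes>\<^bsub>left_group D \<xi>\<^esub> inv\<^bsub>left_group D \<xi>\<^esub> g"
    unfolding halo_act_def
    using left_proj_dashv[OF xi vdash_closed[OF c(1) y] c(2)] fixed[of "inv\<^bsub>left_group D \<xi>\<^esub> g"] g
    by simp
  also have "\<xi> \<stileturn> (g \<turnstile> y) = \<xi> \<stileturn> (g \<stileturn> y)"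
    using dashv_bar HaloD(1)[OF xi] c y by simp
  also have "\<dots> = g \<otimes>\<^bsub>left_group D \<xi>\<^esub> (\<xi> \<stileturn> y)"
    using left_proj_dashv[OF xi c(1) y] fixed[OF g] by simp
  finally show ?thesis .
qed

lemma halo_act_Halo:
  assumes xi: "\<xi> \<in> Halo D" and g: "g \<in> carrier (left_group D \<xi>)" and a: "\<alpha> \<in> Halo D"
  shows "halo_act D \<xi> g \<alpha> \<in> Halo D"
proof -
  interpret G: group "left_group D \<xi>" by (rule left_group_group[OF xi])
  let ?b = "halo_act D \<xi> g \<alpha>"
  have b: "?b \<in> carrier D" using halo_act_closed[OF xi g] HaloD(1)[OF a] .
  have "\<xi> \<stileturn> ?b = g \<otimes>\<^bsub>left_group D \<xi>\<^esub> \<one>\<^bsub>left_group D \<xi>\<^esub> \<otimes>\<^bsub>left_group D \<xi>\<^esub> inv\<^bsub>left_group D \<xi>\<^esub> g"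
    using left_proj_act[OF xi g HaloD(1)[OF a]] left_proj_Halo[OF xi a]
    by simp (simp add: left_group_def)
  also have "\<dots> = \<one>\<^bsub>left_group D \<xi>\<^esub>" using g by simp
  finally have e: "\<xi> \<stileturn> ?b = \<xi>" by (simp add: left_group_def)
  show ?thesis
    using b e dashv_left_proj[OF xi b] left_proj_vdash[OF xi b] HaloD[OF xi]
    by (auto simp: Halo_def bar_unit_def)
qed

theorem rack_Conj: "rack (Conj D)"
proof -
  obtain \<xi> where xi: "\<xi> \<in> Halo D" using Halo_nonempty by auto
  interpret G: group "left_group D \<xi>" by (rule left_group_group[OF xi])
  let ?G = "left_group D \<xi>" and ?act = "halo_act D \<xi>"
  have car: "carrier (Conj D) = carrier D" by (simp add: Conj_def)
  note p = left_proj_closed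
  have one: "\<one>\<^bsub>?G\<^esub> = \<xi>" by (simp add: left_group_def)
  show ?thesis
  proof (unfold_locales, unfold car)
    show "carrier D \<noteq> {}" using HaloD(1)[OF xi] by auto
  next
    fix x assume x: "x \<in> carrier D"
    let ?g = "\<xi> \<stileturn> x" and ?h = "inv\<^bsub>?G\<^esub> (\<xi> \<stileturn> x)"
    have g: "?g \<in> carrier ?G" "?h \<in> carrier ?G" using p[OF x] by auto
    have "?act ?h (?act ?g y) = y" "?act ?g (?act ?h y) = y" if "y \<in> carrier D" for y
      using that halo_act_mult[OF xi g that] halo_act_mult[OF xi g(2,1) that] g
        halo_act_one[OF xi that] one by auto
    then have "bij_betw (?act ?g) (carrier D) (carrier D)"
      using halo_act_closed[OF xi] g by (intro bij_betw_byWitness[where f' = "?act ?h"]) auto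
    then show "bij_betw (\<lambda>y. x \<triangleright>\<^bsub>Conj D\<^esub> y) (carrier D) (carrier D)"
      by (rule bij_betw_cong[THEN iffD1, rotated]) (simp add: Conj_act[OF xi x])
  next
    fix x y z assume x: "x \<in> carrier D" and y: "y \<in> carrier D" and z: "z \<in> carrier D"
    have c: "?act (\<xi> \<stileturn> a) b \<in> carrier D" if "a \<in> carrier D" "b \<in> carrier D" for a b
      using that halo_act_closed[OF xi] p by simp
    let ?g = "\<xi> \<stileturn> x" and ?h = "\<xi> \<stileturn> y"
    have g: "?g \<in> carrier ?G" "?h \<in> carrier ?G" using p x y by auto
    have "?act (\<xi> \<stileturn> ?act ?g y) (?act ?g z) =
        ?act (?g \<otimes>\<^bsub>?G\<^esub> ?h \<otimes>\<^bsub>?G\<^esub> inv\<^bsub>?G\<^esub> ?g \<otimes>\<^bsub>?G\<^esub> ?g) z"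
      using g z by (simp add: left_proj_act[OF xi _ y] halo_act_mult[OF xi])
    also have "?g \<otimes>\<^bsub>?G\<^esub> ?h \<otimes>\<^bsub>?G\<^esub> inv\<^bsub>?G\<^esub> ?g \<otimes>\<^bsub>?G\<^esub> ?g = ?g \<otimes>\<^bsub>?G\<^esub> ?h"
      using g by (simp add: G.m_assoc)
    also have "?act (?g \<otimes>\<^bsub>?G\<^esub> ?h) z = ?act ?g (?act ?h z)"
      using g z by (simp add: halo_act_mult[OF xi])
    finally have "?act (\<xi> \<stileturn> ?act ?g y) (?act ?g z) = ?act ?g (?act ?h z)" .
    then show "x \<triangleright>\<^bsub>Conj D\<^esub> (y \<triangleright>\<^bsub>Conj D\<^esub> z) =
        (x \<triangleright>\<^bsub>Conj D\<^esub> y) \<triangleright>\<^bsub>Conj D\<^esub> (x \<triangleright>\<^bsub>Conj D\<^esub> z)"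
      using x y z c by (simp add: Conj_act[OF xi])
  qed
qed

lemma left_inv:
  assumes xi: "\<xi> \<in> Halo D" and x: "x \<in> carrier D"
  shows "left_inv D \<xi> x \<in> carrier D" "left_inv D \<xi> x \<stileturn> x = \<xi>"
    "is_one_sided_inv D x (left_inv D \<xi> x)"
  using someI_ex[OF left_inv_ex[OF xi x]] xi
  by (auto simp: left_inv_def is_left_inv_def is_one_sided_inv_def)

theorem structure_map_bij:
  assumes xi: "\<xi> \<in> Halo D"
  shows "bij_betw (structure_map D \<xi>) (carrier D) (carrier (product_digroup D \<xi>))"
proof (rule bij_betw_byWitness[where f' = "\<lambda>(g, \<alpha>). \<alpha> \<stileturn> g"])
  interpret G: group "left_group D \<xi>" by (rule left_group_group[OF xi])
  let ?G = "left_group D \<xi>"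
  note H = HaloD[OF xi] and L = left_inv[OF xi]
  have "(x \<stileturn> left_inv D \<xi> x) \<stileturn> (\<xi> \<stileturn> x) = x" if x: "x \<in> carrier D" for x
    by (simp only: dashv_left_proj[OF xi x dashv_closed[OF x L(1)[OF x]]]
        dashv_assoc[OF x L(1)[OF x] x] L(2)[OF x] H(2)[OF x])
  then show "\<forall>x \<in> carrier D. (case structure_map D \<xi> x of (g, \<alpha>) \<Rightarrow> \<alpha> \<stileturn> g) = x"
    by (simp add: structure_map_def)
  have E: "x \<stileturn> left_inv D \<xi> x \<in> Halo D" if x: "x \<in> carrier D" for x
  proof -
    let ?a = "x \<stileturn> left_inv D \<xi> x"
    have a: "?a \<in> carrier D" using L x dashv_closed by auto
    have "\<xi> \<stileturn> ?a = \<one>\<^bsub>?G\<^esub>"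
      using left_proj_dashv[OF xi x L(1)[OF x]] left_proj_inv(2)[OF xi x L(3)[OF x]]
        left_proj_closed[OF x] by simp
    then have "\<xi> \<stileturn> ?a = \<xi>" by (simp add: left_group_def)
    then show ?thesis
      using a dashv_left_proj[OF xi a] left_proj_vdash[OF xi a] H
      by (auto simp: Halo_def bar_unit_def)
  qed
  then show "structure_map D \<xi> ` carrier D \<subseteq> carrier (product_digroup D \<xi>)"
    by (auto simp: structure_map_def product_digroup_def left_proj_closed)
  show "(\<lambda>(g, \<alpha>). \<alpha> \<stileturn> g) ` carrier (product_digroup D \<xi>) \<subseteq> carrier D"
    using left_group_closed[OF xi] HaloD(1) dashv_closed by (auto simp: product_digroup_def)
  show "\<forall>p \<in> carrier (product_digroup D \<xi>).
      structure_map D \<xi> (case p of (g, \<alpha>) \<Rightarrow> \<alpha> \<stileturn> g) = p"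
  proof (clarsimp simp: product_digroup_def)
    fix g a assume g: "g \<in> carrier ?G" and a: "a \<in> Halo D"
    have c: "g \<in> carrier D" "a \<in> carrier D" using g a left_group_closed[OF xi] HaloD(1) by auto
    have x: "a \<stileturn> g \<in> carrier D" using c dashv_closed by auto
    have 1: "\<xi> \<stileturn> (a \<stileturn> g) = g"
      using left_proj_Halo[OF xi a] G.l_one[OF g] dashv_assoc[OF H(1) c(2,1)]
      by (simp add: left_group_def)
    have "(a \<stileturn> g) \<stileturn> left_inv D \<xi> (a \<stileturn> g) = (a \<stileturn> g) \<stileturn> inv\<^bsub>?G\<^esub> g"
      using dashv_one_sided_inv[OF xi x x L(3)[OF x]] 1 by simp
    also have "\<dots> = a \<stileturn> (g \<otimes>\<^bsub>?G\<^esub> inv\<^bsub>?G\<^esub> g)"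
      using dashv_assoc[OF c(2,1) left_group_closed[OF xi G.inv_closed[OF g]]]
      by (simp add: left_group_def)
    also have "\<dots> = a \<stileturn> \<one>\<^bsub>?G\<^esub>" using g by simp
    also have "\<dots> = a" using H(2)[OF c(2)] by (simp add: left_group_def)
    finally show "structure_map D \<xi> (a \<stileturn> g) = (g, a)"
      using 1 by (simp add: structure_map_def)
  qed
qed

theorem structure_map_hom:
  assumes xi: "\<xi> \<in> Halo D" and x: "x \<in> carrier D" and y: "y \<in> carrier D"
  shows "structure_map D \<xi> (x \<turnstile> y) =
      structure_map D \<xi> x \<turnstile>\<^bsub>product_digroup D \<xi>\<^esub> structure_map D \<xi> y"
    and "structure_map D \<xi> (x \<stileturn> y) =
      structure_map D \<xi> x \<stileturn>\<^bsub>product_digroup D \<xi>\<^esub> structure_map D \<xi> y"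
proof -
  interpret G: group "left_group D \<xi>" by (rule left_group_group[OF xi])
  let ?G = "left_group D \<xi>"
  note H = HaloD[OF xi] and L = left_inv[OF xi] and p = left_proj_closed[of _ \<xi>]
  define u v where "u = inv\<^bsub>?G\<^esub> (\<xi> \<stileturn> x)" and "v = inv\<^bsub>?G\<^esub> (\<xi> \<stileturn> y)"
  have uv: "u \<in> carrier D" "v \<in> carrier D"
    using p x y left_group_closed[OF xi] by (auto simp: u_def v_def)
  have c: "x \<turnstile> y \<in> carrier D" "x \<stileturn> y \<in> carrier D"
    using x y vdash_closed dashv_closed by auto
  have S: "structure_map D \<xi> a = (\<xi> \<stileturn> a, a \<stileturn> inv\<^bsub>?G\<^esub> (\<xi> \<stileturn> a))" if "a \<in> carrier D" for a
    using dashv_one_sided_inv[OF xi that that L(3)[OF that]] by (simp add: structure_map_def)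
  have e: "\<xi> \<stileturn> (x \<turnstile> y) = \<xi> \<stileturn> (x \<stileturn> y)" using dashv_bar[OF H(1) x y] by simp
  have i: "inv\<^bsub>?G\<^esub> (\<xi> \<stileturn> (x \<stileturn> y)) = v \<stileturn> u"
    using left_proj_dashv[OF xi x y] G.inv_mult_group[OF p[OF x] p[OF y]]
    by (simp add: u_def v_def) (simp add: left_group_def)
  have "(x \<turnstile> y) \<stileturn> (v \<stileturn> u) = (x \<turnstile> (y \<stileturn> v)) \<stileturn> u"
    using x y uv c by (simp add: inner_assoc dashv_assoc)
  also have "\<dots> = halo_act D \<xi> (\<xi> \<stileturn> x) (y \<stileturn> v)"
    using left_proj_vdash[OF xi x] y uv dashv_closed by (simp add: halo_act_def u_def)
  finally show "structure_map D \<xi> (x \<turnstile> y) =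
      structure_map D \<xi> x \<turnstile>\<^bsub>product_digroup D \<xi>\<^esub> structure_map D \<xi> y"
    using x y c e i left_proj_dashv[OF xi x y] by (simp add: S product_digroup_def v_def)
  have "y \<stileturn> v = y \<stileturn> left_inv D \<xi> y"
    using dashv_one_sided_inv[OF xi y y L(3)[OF y]] by (simp add: v_def)
  have "\<xi> \<stileturn> (y \<stileturn> v) = (\<xi> \<stileturn> y) \<otimes>\<^bsub>?G\<^esub> v"
    using H y uv by (simp add: left_group_def dashv_assoc)
  also have "\<dots> = \<xi>" using p[OF y] by (simp add: v_def) (simp add: left_group_def)
  finally have "x \<stileturn> (y \<stileturn> v) = x"
    using dashv_left_proj[OF xi _ x, of "y \<stileturn> v"] H x y uv dashv_closed by simp
  then have "(x \<stileturn> y) \<stileturn> (v \<stileturn> u) = x \<stileturn> u"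
    using x y uv by (metis dashv_assoc dashv_closed)
  then show "structure_map D \<xi> (x \<stileturn> y) =
      structure_map D \<xi> x \<stileturn>\<^bsub>product_digroup D \<xi>\<^esub> structure_map D \<xi> y"
    using x y c i left_proj_dashv[OF xi x y] by (simp add: S product_digroup_def u_def)
qed

end

end

theory Submission
  imports Defs
begin

text \<open>Under the structure map the conjugation rack of \<open>D\<close> becomes
  \<open>(g, \<alpha>) \<triangleright> (h, \<beta>) = (g h g\<^sup>-\<^sup>1, g \<bullet> \<beta>)\<close>, with no dependence on \<open>\<alpha>\<close>. Finiteness reduces
  being a subrack to closure under \<open>\<triangleright>\<close>, and closure of \<open>X\<close> is read off fibrewise.\<close>

text \<open>A left translation is injective; if it maps the finite set \<open>S\<close> into itself,
  it maps \<open>S\<close> onto itself, so every element of \<open>S\<close> already has its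
  preimage in \<open>S\<close>.\<close>

lemma (in rack) subrack_iff_closed_of_finite:
  assumes "finite S"
  shows "subrack S R \<longleftrightarrow>
    S \<noteq> {} \<and> S \<subseteq> carrier R \<and> (\<forall>x \<in> S. \<forall>y \<in> S. x \<triangleright> y \<in> S)"
proof -
  have "inv_into (carrier R) (\<lambda>z. x \<triangleright> z) y \<in> S"
    if S: "S \<subseteq> carrier R" "\<forall>x \<in> S. \<forall>y \<in> S. x \<triangleright> y \<in> S" and xy: "x \<in> S" "y \<in> S" for x y
  proof -
    have inj: "inj_on (\<lambda>z. x \<triangleright> z) (carrier R)"
      using bij S(1) xy(1) by (auto simp: bij_betw_def)
    have "(\<lambda>z. x \<triangleright> z) ` S = S"
      using S xy(1) by (intro endo_inj_surj[OF assms] inj_on_subset[OF inj]) auto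
    then obtain z where "z \<in> S" "y = x \<triangleright> z"
      using xy(2) by (metis imageE)
    \<comment> \<open>\<open>inv_into\<close> searches the whole carrier, so injectivity there, not
      merely on \<open>S\<close>, identifies its value with this \<open>z\<close>.\<close>
    then show ?thesis
      using inv_into_f_f[OF inj] S(1) by auto
  qed
  then show ?thesis
    unfolding subrack_def by blast
qed

context generalized_digroup
begin

text \<open>Choosing \<open>left_inv D \<xi> x\<close> as the one-sided inverse writes the rack
  operation with the two digroup products, and the structure map preserves both.\<close>

lemma structure_map_Conj:
  assumes xi: "\<xi> \<in> Halo D" and x: "x \<in> carrier D" and y: "y \<in> carrier D"
    and sx: "structure_map D \<xi> x = (g, \<alpha>)" and sy: "structure_map D \<xi> y = (h, \<beta>)"
  shows "structure_map D \<xi> (x \<triangleright>\<^bsub>Conj D\<^esub> y) =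
    (g \<otimes>\<^bsub>left_group D \<xi>\<^esub> h \<otimes>\<^bsub>left_group D \<xi>\<^esub> inv\<^bsub>left_group D \<xi>\<^esub> g, halo_act D \<xi> g \<beta>)"
proof -
  note L = left_inv[OF xi x]
  \<comment> \<open>\<open>\<gamma>\<close> can stay unspecified: in the product digroup,
    \<open>\<stileturn>\<close> keeps the halo coordinate of its left operand, and this inverse
    enters on the right.\<close>
  obtain \<gamma> where "structure_map D \<xi> (left_inv D \<xi> x) = (inv\<^bsub>left_group D \<xi>\<^esub> g, \<gamma>)"
    using left_proj_inv(2)[OF xi x L(3)] sx by (simp add: structure_map_def)
  then show ?thesis
    using sx sy L(1) x y xi
    by (simp add: Conj_eq[OF x y L(3)] structure_map_hom vdash_closed product_digroup_def)
qed

end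

theorem theorem4p6:
  fixes D :: "('a, 'm) digroup_scheme" and \<xi> :: 'a
    and G :: "'a monoid" and E :: "'a set"
    and X :: "('a \<times> 'a) set" and Y :: "'a set" and X_at :: "'a \<Rightarrow> 'a set"
  assumes "generalized_digroup D" and "finite (carrier D)" and "\<xi> \<in> Halo D"
    and "G = left_group D \<xi>" and "E = Halo D"
    and "X \<subseteq> carrier G \<times> E" and "X \<noteq> {}"
    and "Y = fst ` X"
    and "X_at = (\<lambda>g. {\<beta> \<in> E. (g, \<beta>) \<in> X})"
  shows "subrack {x \<in> carrier D. structure_map D \<xi> x \<in> X} (Conj D) \<longleftrightarrow>
    subrack Y (Conj_group G) \<and>
    (\<forall>g \<in> Y. \<forall>h \<in> Y. halo_act D \<xi> g ` X_at h \<subseteq> X_at (g \<otimes>\<^bsub>G\<^esub> h \<otimes>\<^bsub>G\<^esub> inv\<^bsub>G\<^esub> g))"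
proof -
  interpret D: generalized_digroup D by fact
  interpret G: group G
    using D.left_group_group assms by simp
  interpret C: rack "Conj D" by (rule D.rack_Conj)
  interpret CG: rack "Conj_group G" by (rule G.rack_Conj_group)
  let ?s = "structure_map D \<xi>" and ?S = "{x \<in> carrier D. structure_map D \<xi> x \<in> X}"
  let ?c = "\<lambda>g h. g \<otimes>\<^bsub>G\<^esub> h \<otimes>\<^bsub>G\<^esub> inv\<^bsub>G\<^esub> g"
  have "?s ` carrier D = carrier G \<times> E"
    using D.structure_map_bij[OF \<open>\<xi> \<in> Halo D\<close>] assms by (simp add: bij_betw_def product_digroup_def)
  \<comment> \<open>Surjectivity of the structure map: \<open>?S\<close> is the preimage of
    \<open>X\<close>, and closure can be tested on pairs only if every pair of \<open>X\<close> is
    hit.\<close>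
  then have lift: "\<exists>x \<in> ?S. ?s x = p" if "p \<in> X" for p
  proof -
    have "p \<in> ?s ` carrier D"
      using that \<open>X \<subseteq> carrier G \<times> E\<close> \<open>?s ` carrier D = _\<close> by blast
    then show ?thesis
      using that by auto
  qed
  have car: "carrier (Conj D) = carrier D"
    by (simp add: Conj_def)
  have S_iff: "subrack ?S (Conj D) \<longleftrightarrow>
      (\<forall>g \<alpha> h \<beta>. (g, \<alpha>) \<in> X \<longrightarrow> (h, \<beta>) \<in> X \<longrightarrow> (?c g h, halo_act D \<xi> g \<beta>) \<in> X)"
    (is "_ \<longleftrightarrow> ?closed")
  proof -
    have "?S \<noteq> {}"
      using lift \<open>X \<noteq> {}\<close> by blast
    then have "subrack ?S (Conj D) \<longleftrightarrow> (\<forall>x \<in> ?S. \<forall>y \<in> ?S. x \<triangleright>\<^bsub>Conj D\<^esub> y \<in> ?S)"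
      using C.subrack_iff_closed_of_finite[of ?S] \<open>finite (carrier D)\<close> by (simp add: car)
    \<comment> \<open>Left translations map \<open>carrier D\<close> to itself, so only membership
      of the image in \<open>X\<close> remains.\<close>
    also have "\<dots> \<longleftrightarrow> (\<forall>x \<in> ?S. \<forall>y \<in> ?S. ?s (x \<triangleright>\<^bsub>Conj D\<^esub> y) \<in> X)"
      using C.bij car by (auto dest!: bij_betwE)
    also have "\<dots> \<longleftrightarrow> ?closed"
    proof
      assume *: "\<forall>x \<in> ?S. \<forall>y \<in> ?S. ?s (x \<triangleright>\<^bsub>Conj D\<^esub> y) \<in> X"
      show ?closed
      proof (intro allI impI)
        fix g \<alpha> h \<beta> assume "(g, \<alpha>) \<in> X" "(h, \<beta>) \<in> X"
        then obtain x y where xy: "x \<in> ?S" "?s x = (g, \<alpha>)" "y \<in> ?S" "?s y = (h, \<beta>)"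
          using lift[of "(g, \<alpha>)"] lift[of "(h, \<beta>)"] by blast
        then have "?s (x \<triangleright>\<^bsub>Conj D\<^esub> y) \<in> X"
          using * by blast
        then show "(?c g h, halo_act D \<xi> g \<beta>) \<in> X"
          using xy D.structure_map_Conj[OF \<open>\<xi> \<in> Halo D\<close>, of x y] \<open>G = left_group D \<xi>\<close> by simp
      qed
    next
      assume *: ?closed
      show "\<forall>x \<in> ?S. \<forall>y \<in> ?S. ?s (x \<triangleright>\<^bsub>Conj D\<^esub> y) \<in> X"
      proof (intro ballI)
        fix x y assume xy: "x \<in> ?S" "y \<in> ?S"
        obtain g \<alpha> h \<beta> where s: "?s x = (g, \<alpha>)" "?s y = (h, \<beta>)"
          by (meson surj_pair)
        then have "(?c g h, halo_act D \<xi> g \<beta>) \<in> X"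
          using * xy by auto
        then show "?s (x \<triangleright>\<^bsub>Conj D\<^esub> y) \<in> X"
          using s xy D.structure_map_Conj[OF \<open>\<xi> \<in> Halo D\<close>, of x y] \<open>G = left_group D \<xi>\<close> by simp
      qed
    qed
    finally show ?thesis .
  qed
  have "Y \<subseteq> carrier G"
    using assms by auto
  \<comment> \<open>The left group lies inside \<open>carrier D\<close>.\<close>
  moreover have "finite Y"
    using \<open>Y \<subseteq> carrier G\<close> D.left_group_closed[OF \<open>\<xi> \<in> Halo D\<close>] \<open>G = left_group D \<xi>\<close>
    by (intro finite_subset[OF _ \<open>finite (carrier D)\<close>]) blast
  moreover have "Y \<noteq> {}"
    using assms by simp
  ultimately have Y_iff: "subrack Y (Conj_group G) \<longleftrightarrow> (\<forall>g \<in> Y. \<forall>h \<in> Y. ?c g h \<in> Y)"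
    by (simp add: CG.subrack_iff_closed_of_finite) (simp add: Conj_group_def)
  have fibre: "\<beta> \<in> X_at g \<longleftrightarrow> (g, \<beta>) \<in> X" for g \<beta>
    using assms(6,9) by auto
  have base: "g \<in> Y \<longleftrightarrow> (\<exists>\<beta>. (g, \<beta>) \<in> X)" for g
    using assms(8) by force
  \<comment> \<open>In the closure condition \<alpha> occurs only in
    \<open>(g, \<alpha>) \<in> X\<close>, so quantifying over it leaves \<open>g \<in> Y\<close>.
    The pair \<open>(h, \<beta>)\<close> becomes a base point \<open>h\<close> with \<beta> in its
    fibre. Closure of \<open>Y\<close> comes from choosing any \<beta> over
    \<open>h\<close>.\<close>
  show ?thesis
    unfolding S_iff Y_iff image_subset_iff Ball_def fibre base by blast
qed

end
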